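(* Assume that for every level $\ell\in\{0,\dots,\bar L\}$ and every finite (ordered) sample set $\Omega_k\subset\Omega$ of size $n_k\ge 1$, the mapping $$\mathbb{R}^{m_\ell^d}\to\mathbb{R}^{m_\ell^d}:\quad \mathbf{v}\mapsto \frac{1}{n_k}\sum_{\omega\in\Omega_k}\mathbf{Q}_{m_\ell}(\mathbf{v},\omega,\Omega_k)$$ is the exact gradient of some cost function on $\mathbb{R}^{m_\ell^d}$. Let $0\le L\le\bar L$ and let $\Omega_0,\dots,\Omega_L\subset\Omega$ be the (ordered) sample sets of sizes $n_0,\dots,n_L$ used by the multilevel Monte Carlo (MLMC) method on levels $0,\dots,L$. Then the mapping $\mathbb{R}^{m_{\bar L}^d}\to\mathbb{R}^{m_{\bar L}^d}$ described by the MLMC method, $$\mathbf{u}\mapsto\nabla\hat J(\mathbf{u}):=\sum_{\ell=0}^{L} I_\ell^{\bar L}\,\frac{1}{n_\ell}\sum_{\omega\in\Omega_\ell}\Big(\mathbf{Q}_{m_\ell}(I_{\bar L}^{\ell}\mathbf{u},\omega,\Omega_\ell)-I_{\ell-1}^{\ell}\,\mathbf{Q}_{m_{\ell-1}}(I_{\bar L}^{\ell-1}\mathbf{u},\omega,\Omega_\ell)\Big)$$ (where the term with index $\ell-1$ is absent for $\ell=0$), is itself the exact gradient of some cost function $\hat J:\mathbb{R}^{m_{\bar L}^d}\to\mathbb{R}$.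
   Context: $\Omega$ is the sample space. There are grid levels $\ell=0,\dots,\bar L$ with $m_\ell=m_0 2^\ell$ grid points per dimension in $d$ dimensions, so grid functions on level $\ell$ are vectors in $\mathbb{R}^{m_\ell^d}$. On level $\ell$ the inner product is $(\mathbf{v},\mathbf{w})=\mathbf{v}^T\mathbf{w}/m_\ell^d$. A mapping $G:\mathbb{R}^{m_\ell^d}\to\mathbb{R}^{m_\ell^d}$ is the exact gradient of a cost function $F:\mathbb{R}^{m_\ell^d}\to\mathbb{R}$ if $F$ is differentiable and its derivative at $\mathbf{v}$ in direction $\mathbf{h}$ equals $(G(\mathbf{v}),\mathbf{h})$ for all $\mathbf{v},\mathbf{h}$, with the inner product of that level. For levels $\ell_1,\ell_2$, $I_{\ell_1}^{\ell_2}:\mathbb{R}^{m_{\ell_1}^d}\to\mathbb{R}^{m_{\ell_2}^d}$ is a linear transfer operator, equal to the identity if $\ell_1=\ell_2$. For $\ell_1<\ell_2$ it satisfies $I_{\ell_1}^{\ell_2}=I_{\ell_2-1}^{\ell_2}I_{\ell_2-2}^{\ell_2-1}\cdots I_{\ell_1}^{\ell_1+1}$ and $I_{\ell_1}^{\ell_2}=c^{\ell_2-\ell_1}(I_{\ell_2}^{\ell_1})^T$ for some constant $c>0$ independent of the levels; the analogous expressions hold for $\ell_1>\ell_2$. For each level $\ell$, $\mathbf{v}\in\mathbb{R}^{m_\ell^d}$, finite ordered sample set $\Omega_k\subset\Omega$ and $\omega\in\Omega_k$, $\mathbf{Q}_{m_\ell}(\mathbf{v},\omega,\Omega_k)\in\mathbb{R}^{m_\ell^d}$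 denotes a sample (of a gradient) on level $\ell$ at the point $\mathbf{v}$; it is indexed by $\omega$ but may depend on several elements of the ordered set $\Omega_k$. The same sample set $\Omega_\ell$ is used for both terms of the level-$\ell$ correction. The sample sets and $L$ are fixed, i.e., they do not depend on $\mathbf{u}$. *)

theory Defs
  imports Complex_Main "Jordan_Normal_Form.Matrix"
begin

(* The dimensions of the spaces vary with the level, so R^N is rendered as carrier_vec N.
   Functions defined on R^N are total functions on real vec of which only the values on
   carrier_vec N matter. *)

definition level_dim :: "nat \<Rightarrow> nat \<Rightarrow> nat \<Rightarrow> nat" where
  "level_dim m0 d l = (m0 * 2 ^ l) ^ d"

definition grid_inner :: "nat \<Rightarrow> real vec \<Rightarrow> real vec \<Rightarrow> real" where
  "grid_inner N v w = (v \<bullet> w) / real N"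

definition euclidean_norm :: "real vec \<Rightarrow> real" where
  "euclidean_norm v = sqrt (v \<bullet> v)"

(* Frechet derivative of F : R^N \<rightarrow> R at v; the type real vec carries no norm, so that
   has_derivative is not available.  Boundedness of D is automatic in finite dimension. *)
definition has_frechet_derivative ::
  "nat \<Rightarrow> (real vec \<Rightarrow> real) \<Rightarrow> (real vec \<Rightarrow> real) \<Rightarrow> real vec \<Rightarrow> bool" where
  "has_frechet_derivative N F D v \<longleftrightarrow>
     (\<forall>h\<in>carrier_vec N. \<forall>k\<in>carrier_vec N. D (h + k) = D h + D k) \<and>
     (\<forall>a. \<forall>h\<in>carrier_vec N. D (a \<cdot>\<^sub>v h) = a * D h) \<and>
     (\<forall>e>0. \<exists>r>0. \<forall>h\<in>carrier_vec N. euclidean_norm h < r \<longrightarrow>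
        \<bar>F (v + h) - F v - D h\<bar> \<le> e * euclidean_norm h)"

definition exact_gradient ::
  "nat \<Rightarrow> (real vec \<Rightarrow> real vec) \<Rightarrow> (real vec \<Rightarrow> real) \<Rightarrow> bool" where
  "exact_gradient N G F \<longleftrightarrow>
     G \<in> carrier_vec N \<rightarrow> carrier_vec N \<and>
     (\<forall>v\<in>carrier_vec N. has_frechet_derivative N F (\<lambda>h. grid_inner N (G v) h) v)"

(* ascend N I l k = I_{l+k-1}^{l+k} \<dots> I_l^{l+1}, where I a b is the transfer from level a to b *)
primrec ascend :: "(nat \<Rightarrow> nat) \<Rightarrow> (nat \<Rightarrow> nat \<Rightarrow> real mat) \<Rightarrow> nat \<Rightarrow> nat \<Rightarrow> real mat" where
  "ascend N I l 0 = 1\<^sub>m (N l)"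
| "ascend N I l (Suc k) = I (l + k) (l + Suc k) * ascend N I l k"

(* descend N I l k = I_{l-k+1}^{l-k} \<dots> I_l^{l-1}, used for k \<le> l only *)
primrec descend :: "(nat \<Rightarrow> nat) \<Rightarrow> (nat \<Rightarrow> nat \<Rightarrow> real mat) \<Rightarrow> nat \<Rightarrow> nat \<Rightarrow> real mat" where
  "descend N I l 0 = 1\<^sub>m (N l)"
| "descend N I l (Suc k) = I (l - k) (l - Suc k) * descend N I l k"

(* In the transpose relation the exponent l2 - l1 is an integer, so that the relation for
   l1 > l2 is the one for l1 < l2 solved for the other operator. *)
definition transfer_operators ::
  "(nat \<Rightarrow> nat) \<Rightarrow> nat \<Rightarrow> real \<Rightarrow> (nat \<Rightarrow> nat \<Rightarrow> real mat) \<Rightarrow> bool" where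
  "transfer_operators N Lbar c I \<longleftrightarrow>
     (\<forall>l1\<le>Lbar. \<forall>l2\<le>Lbar. I l1 l2 \<in> carrier_mat (N l2) (N l1)) \<and>
     (\<forall>l\<le>Lbar. I l l = 1\<^sub>m (N l)) \<and>
     (\<forall>l1\<le>Lbar. \<forall>l2\<le>Lbar. l1 < l2 \<longrightarrow> I l1 l2 = ascend N I l1 (l2 - l1)) \<and>
     (\<forall>l1\<le>Lbar. \<forall>l2\<le>Lbar. l1 > l2 \<longrightarrow> I l1 l2 = descend N I l1 (l1 - l2)) \<and>
     (\<forall>l1\<le>Lbar. \<forall>l2\<le>Lbar. l1 \<noteq> l2 \<longrightarrow>
        I l1 l2 = (c powi (int l2 - int l1)) \<cdot>\<^sub>m (I l2 l1)\<^sup>T)"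

(* Ordered sample sets are lists without repetition. *)
definition sample_set :: "'w set \<Rightarrow> 'w list \<Rightarrow> bool" where
  "sample_set \<Omega> S \<longleftrightarrow> distinct S \<and> set S \<subseteq> \<Omega> \<and> length S \<ge> 1"

definition sample_mean :: "nat \<Rightarrow> 'w list \<Rightarrow> ('w \<Rightarrow> real vec) \<Rightarrow> real vec" where
  "sample_mean n S X = (1 / real (length S)) \<cdot>\<^sub>v finsum_vec TYPE(real) n X (set S)"

definition mlmc_gradient ::
  "(nat \<Rightarrow> nat) \<Rightarrow> (nat \<Rightarrow> nat \<Rightarrow> real mat) \<Rightarrow> nat \<Rightarrow>
   (nat \<Rightarrow> real vec \<Rightarrow> 'w \<Rightarrow> 'w list \<Rightarrow> real vec) \<Rightarrow> nat \<Rightarrow> (nat \<Rightarrow> 'w list) \<Rightarrow>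
   real vec \<Rightarrow> real vec" where
  "mlmc_gradient N I Lbar Q L S u =
     finsum_vec TYPE(real) (N Lbar)
       (\<lambda>l. I l Lbar *\<^sub>v sample_mean (N l) (S l)
          (\<lambda>\<omega>. if l = 0 then Q 0 (I Lbar 0 *\<^sub>v u) \<omega> (S 0)
               else Q l (I Lbar l *\<^sub>v u) \<omega> (S l)
                    - I (l - 1) l *\<^sub>v Q (l - 1) (I Lbar (l - 1) *\<^sub>v u) \<omega> (S l)))
       {0..L}"

end

theory Submission
  imports Defs
begin

text \<open>
  Exact gradients are closed under linear combinations, so it suffices to
  look at the summands of the multilevel estimator one at a time.  They all have one shape.  By
  linearity of the sample mean, the level-\<open>l\<close> correction for \<open>l > 0\<close> splits into the
  mean of the fine samples minus the transferred mean of the coarse samples, both taken over the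
  same sample set.  Since upward
  transfers compose, \<open>I l Lbar * I (l - 1) l = I (l - 1) Lbar\<close>, both parts are of the form
  \<open>u \<mapsto> \<plusminus> I k Lbar *\<^sub>v G (I Lbar k *\<^sub>v u)\<close> with \<open>G\<close> a sample mean on level \<open>k\<close>, hence the exact
  gradient of some cost function \<open>F\<close> by hypothesis.  For the coarse part it matters that the
  hypothesis ranges over all pairs of a level and a sample set: it is used for the level \<open>l - 1\<close>
  with the sample set of level \<open>l\<close>.

  Such a map is a gradient because prolongation is, up to a constant \<open>s\<close>, the transpose of
  restriction.  With \<open>A = I Lbar k\<close> the chain rule gives \<open>F (A u)\<close> the derivative
  \<open>h \<mapsto> (G (A u) \<bullet> A h) / N k = (A\<^sup>T G (A u) \<bullet> h) / N k\<close>, so in the inner product of level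
  \<open>Lbar\<close> the map \<open>u \<mapsto> s A\<^sup>T G (A u)\<close> is the exact gradient of \<open>u \<mapsto> s (N k / N Lbar) F (A u)\<close>.
  The factor \<open>N k / N Lbar\<close> is the ratio of the weights in the two inner products.
  Lemma \<open>exact_gradient_pullback\<close> carries this argument.
\<close>

section \<open>Matrices, vectors and sample means\<close>

lemma smult_mat_mult_vec:
  fixes A :: "real mat"
  assumes "A \<in> carrier_mat n m" and "v \<in> carrier_vec m"
  shows "(s \<cdot>\<^sub>m A) *\<^sub>v v = s \<cdot>\<^sub>v (A *\<^sub>v v)"
  using assms by (intro eq_vecI) (auto simp: scalar_prod_def sum_distrib_left ac_simps)

lemma mult_mat_vec_index_sum:
  assumes "A \<in> carrier_mat n m" and "v \<in> carrier_vec m" and "i < n"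
  shows "(A *\<^sub>v v) $ i = (\<Sum>j<m. A $$ (i, j) * v $ j)"
  using assms by (auto simp: scalar_prod_def atLeast0LessThan intro!: sum.cong)

lemma sample_mean_carrier:
  assumes "\<And>\<omega>. \<omega> \<in> set S \<Longrightarrow> X \<omega> \<in> carrier_vec n"
  shows "sample_mean n S X \<in> carrier_vec n"
  using assms by (auto simp: sample_mean_def intro!: finsum_vec_closed)

lemma sample_mean_index:
  assumes "\<And>\<omega>. \<omega> \<in> set S \<Longrightarrow> X \<omega> \<in> carrier_vec n" and "i < n"
  shows "sample_mean n S X $ i = (\<Sum>\<omega>\<in>set S. X \<omega> $ i) / real (length S)"
proof -
  have "finsum_vec TYPE(real) n X (set S) \<in> carrier_vec n"
    using assms(1) by (intro finsum_vec_closed) auto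
  moreover have "finsum_vec TYPE(real) n X (set S) $ i = (\<Sum>\<omega>\<in>set S. X \<omega> $ i)"
    using assms by (intro index_finsum_vec) auto
  ultimately show ?thesis
    using assms(2) by (simp add: sample_mean_def)
qed

lemma sample_mean_diff_mult_mat:
  assumes A: "A \<in> carrier_mat n k"
    and X: "\<And>\<omega>. \<omega> \<in> set S \<Longrightarrow> X \<omega> \<in> carrier_vec n"
    and Y: "\<And>\<omega>. \<omega> \<in> set S \<Longrightarrow> Y \<omega> \<in> carrier_vec k"
  shows "sample_mean n S (\<lambda>\<omega>. X \<omega> - A *\<^sub>v Y \<omega>) = sample_mean n S X - A *\<^sub>v sample_mean k S Y"
proof (rule eq_vecI)
  have AY: "A *\<^sub>v Y \<omega> \<in> carrier_vec n" if "\<omega> \<in> set S" for \<omega>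
    using A Y[OF that] by simp
  have Xd: "X \<omega> - A *\<^sub>v Y \<omega> \<in> carrier_vec n" if "\<omega> \<in> set S" for \<omega>
    using X[OF that] AY[OF that] by simp
  note mX = sample_mean_carrier[of S X n, OF X]
  note mY = sample_mean_carrier[of S Y k, OF Y]
  have AmY: "A *\<^sub>v sample_mean k S Y \<in> carrier_vec n"
    using A mY by simp
  show "dim_vec (sample_mean n S (\<lambda>\<omega>. X \<omega> - A *\<^sub>v Y \<omega>))
      = dim_vec (sample_mean n S X - A *\<^sub>v sample_mean k S Y)"
    using sample_mean_carrier[of S "\<lambda>\<omega>. X \<omega> - A *\<^sub>v Y \<omega>" n, OF Xd] mX AmY A by simp
  fix i assume "i < dim_vec (sample_mean n S X - A *\<^sub>v sample_mean k S Y)"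
  then have i: "i < n"
    using A by simp
  have "(A *\<^sub>v sample_mean k S Y) $ i
      = (\<Sum>j<k. A $$ (i, j) * ((\<Sum>\<omega>\<in>set S. Y \<omega> $ j) / real (length S)))"
    by (subst mult_mat_vec_index_sum[OF A mY i])
      (auto intro!: sum.cong simp: sample_mean_index[of S Y k, OF Y])
  also have "\<dots> = (\<Sum>j<k. \<Sum>\<omega>\<in>set S. A $$ (i, j) * Y \<omega> $ j) / real (length S)"
    by (simp add: sum_divide_distrib sum_distrib_left)
  also have "\<dots> = (\<Sum>\<omega>\<in>set S. \<Sum>j<k. A $$ (i, j) * Y \<omega> $ j) / real (length S)"
    by (subst sum.swap) simp
  also have "\<dots> = (\<Sum>\<omega>\<in>set S. (A *\<^sub>v Y \<omega>) $ i) / real (length S)"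
    using mult_mat_vec_index_sum[OF A Y i] by simp
  finally have AmY_i:
    "(A *\<^sub>v sample_mean k S Y) $ i = (\<Sum>\<omega>\<in>set S. (A *\<^sub>v Y \<omega>) $ i) / real (length S)" .
  have "sample_mean n S (\<lambda>\<omega>. X \<omega> - A *\<^sub>v Y \<omega>) $ i
      = (\<Sum>\<omega>\<in>set S. (X \<omega> - A *\<^sub>v Y \<omega>) $ i) / real (length S)"
    by (rule sample_mean_index[OF Xd i])
  also have "(\<Sum>\<omega>\<in>set S. (X \<omega> - A *\<^sub>v Y \<omega>) $ i)
      = (\<Sum>\<omega>\<in>set S. X \<omega> $ i - (A *\<^sub>v Y \<omega>) $ i)"
    using AY i by (intro sum.cong refl index_minus_vec(1)) (metis carrier_vecD)
  finally have "sample_mean n S (\<lambda>\<omega>. X \<omega> - A *\<^sub>v Y \<omega>) $ i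
      = sample_mean n S X $ i - (A *\<^sub>v sample_mean k S Y) $ i"
    by (simp only: AmY_i sample_mean_index[OF X i] sum_subtractf diff_divide_distrib)
  then show "sample_mean n S (\<lambda>\<omega>. X \<omega> - A *\<^sub>v Y \<omega>) $ i
      = (sample_mean n S X - A *\<^sub>v sample_mean k S Y) $ i"
    using i A by simp
qed

lemma euclidean_norm_sum:
  assumes "v \<in> carrier_vec n"
  shows "euclidean_norm v = sqrt (\<Sum>i<n. (v $ i)\<^sup>2)"
  using assms by (simp add: euclidean_norm_def scalar_prod_def atLeast0LessThan power2_eq_square)

lemma euclidean_norm_nonneg: "euclidean_norm v \<ge> 0"
  by (simp add: euclidean_norm_def scalar_prod_def sum_nonneg)

lemma abs_index_le_euclidean_norm:
  assumes "v \<in> carrier_vec n" and "i < n"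
  shows "\<bar>v $ i\<bar> \<le> euclidean_norm v"
proof -
  have "(v $ i)\<^sup>2 \<le> (\<Sum>i<n. (v $ i)\<^sup>2)"
    using assms(2) by (intro member_le_sum) auto
  then show ?thesis
    unfolding euclidean_norm_sum[OF assms(1)] by (rule real_le_rsqrt[of "\<bar>v $ i\<bar>", simplified])
qed

text \<open>
  Bounding every entry of \<open>v\<close> by the norm of \<open>v\<close> yields an operator bound that is far from
  sharp, but the chain rule only asks for some finite constant.
\<close>

lemma euclidean_norm_mult_mat_le:
  assumes A: "A \<in> carrier_mat n m"
  obtains K where "K > 0"
    and "\<And>v. v \<in> carrier_vec m \<Longrightarrow> euclidean_norm (A *\<^sub>v v) \<le> K * euclidean_norm v"
proof
  define r where "r i = (\<Sum>j<m. \<bar>A $$ (i, j)\<bar>)" for i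
  define K where "K = sqrt (\<Sum>i<n. (r i)\<^sup>2)"
  have "K \<ge> 0"
    by (simp add: K_def sum_nonneg)
  then show "K + 1 > 0"
    by simp
  fix v :: "real vec" assume v: "v \<in> carrier_vec m"
  have row: "\<bar>(A *\<^sub>v v) $ i\<bar> \<le> r i * euclidean_norm v" if "i < n" for i
  proof -
    have "\<bar>(A *\<^sub>v v) $ i\<bar> \<le> (\<Sum>j<m. \<bar>A $$ (i, j) * v $ j\<bar>)"
      by (subst mult_mat_vec_index_sum[OF A v that]) (rule sum_abs)
    also have "\<dots> \<le> (\<Sum>j<m. \<bar>A $$ (i, j)\<bar> * euclidean_norm v)"
      using abs_index_le_euclidean_norm[OF v]
      by (intro sum_mono) (auto simp: abs_mult intro: mult_left_mono)
    finally show ?thesis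
      by (simp add: r_def sum_distrib_right)
  qed
  have "(\<Sum>i<n. ((A *\<^sub>v v) $ i)\<^sup>2) \<le> (\<Sum>i<n. (r i * euclidean_norm v)\<^sup>2)"
  proof (rule sum_mono)
    fix i assume "i \<in> {..<n}"
    then show "((A *\<^sub>v v) $ i)\<^sup>2 \<le> (r i * euclidean_norm v)\<^sup>2"
      using power_mono[OF row[of i] abs_ge_zero, of 2] by simp
  qed
  also have "\<dots> = (K * euclidean_norm v)\<^sup>2"
    by (simp add: K_def power_mult_distrib sum_distrib_right sum_nonneg)
  finally have "euclidean_norm (A *\<^sub>v v) \<le> K * euclidean_norm v"
    using A v \<open>K \<ge> 0\<close> euclidean_norm_nonneg[of v]
    by (subst euclidean_norm_sum[of _ n]) (auto intro!: real_le_lsqrt)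
  also have "\<dots> \<le> (K + 1) * euclidean_norm v"
    using euclidean_norm_nonneg[of v] by (intro mult_right_mono) auto
  finally show "euclidean_norm (A *\<^sub>v v) \<le> (K + 1) * euclidean_norm v" .
qed

section \<open>Calculus of Frechet derivatives\<close>

lemma has_frechet_derivativeI:
  assumes "\<And>h k. h \<in> carrier_vec n \<Longrightarrow> k \<in> carrier_vec n \<Longrightarrow> D (h + k) = D h + D k"
    and "\<And>a h. h \<in> carrier_vec n \<Longrightarrow> D (a \<cdot>\<^sub>v h) = a * D h"
    and "\<And>e. e > 0 \<Longrightarrow> \<exists>r>0. \<forall>h\<in>carrier_vec n. euclidean_norm h < r \<longrightarrow>
      \<bar>F (v + h) - F v - D h\<bar> \<le> e * euclidean_norm h"
  shows "has_frechet_derivative n F D v"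
  using assms unfolding has_frechet_derivative_def by blast

lemma has_frechet_derivative_remainder:
  assumes "has_frechet_derivative n F D v" and "e > 0"
  obtains r where "r > 0"
    and "\<And>h. h \<in> carrier_vec n \<Longrightarrow> euclidean_norm h < r \<Longrightarrow>
      \<bar>F (v + h) - F v - D h\<bar> \<le> e * euclidean_norm h"
  using assms unfolding has_frechet_derivative_def by blast

lemma has_frechet_derivative_additive:
  assumes "has_frechet_derivative n F D v" "h \<in> carrier_vec n" "k \<in> carrier_vec n"
  shows "D (h + k) = D h + D k"
  using assms unfolding has_frechet_derivative_def by blast

lemma has_frechet_derivative_homogeneous:
  assumes "has_frechet_derivative n F D v" "h \<in> carrier_vec n"
  shows "D (a \<cdot>\<^sub>v h) = a * D h"
  using assms unfolding has_frechet_derivative_def by blast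

lemma has_frechet_derivative_cong:
  assumes F: "has_frechet_derivative n F D v"
    and eq: "\<And>h. h \<in> carrier_vec n \<Longrightarrow> D' h = D h"
  shows "has_frechet_derivative n F D' v"
proof (rule has_frechet_derivativeI)
  fix e :: real assume "e > 0"
  obtain r where "r > 0" and "\<And>h. h \<in> carrier_vec n \<Longrightarrow> euclidean_norm h < r \<Longrightarrow>
      \<bar>F (v + h) - F v - D h\<bar> \<le> e * euclidean_norm h"
    using has_frechet_derivative_remainder[OF F \<open>e > 0\<close>] by metis
  then show "\<exists>r>0. \<forall>h\<in>carrier_vec n. euclidean_norm h < r \<longrightarrow>
      \<bar>F (v + h) - F v - D' h\<bar> \<le> e * euclidean_norm h"
    by (auto simp: eq)
qed (use has_frechet_derivative_additive[OF F] has_frechet_derivative_homogeneous[OF F] eq in auto)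

lemma has_frechet_derivative_const: "has_frechet_derivative n (\<lambda>v. c) (\<lambda>h. 0) v"
  by (rule has_frechet_derivativeI) (auto intro!: exI[of _ 1] simp: euclidean_norm_nonneg)

lemma has_frechet_derivative_add:
  assumes F: "has_frechet_derivative n F D v" and F': "has_frechet_derivative n F' D' v"
  shows "has_frechet_derivative n (\<lambda>v. F v + F' v) (\<lambda>h. D h + D' h) v"
proof (rule has_frechet_derivativeI)
  fix e :: real assume "e > 0"
  then have e2: "e / 2 > 0"
    by simp
  obtain r where r: "r > 0" "\<And>h. h \<in> carrier_vec n \<Longrightarrow> euclidean_norm h < r \<Longrightarrow>
      \<bar>F (v + h) - F v - D h\<bar> \<le> e / 2 * euclidean_norm h"
    using has_frechet_derivative_remainder[OF F e2] by metis
  obtain r' where r': "r' > 0" "\<And>h. h \<in> carrier_vec n \<Longrightarrow> euclidean_norm h < r' \<Longrightarrow>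
      \<bar>F' (v + h) - F' v - D' h\<bar> \<le> e / 2 * euclidean_norm h"
    using has_frechet_derivative_remainder[OF F' e2] by metis
  have "\<bar>F (v + h) + F' (v + h) - (F v + F' v) - (D h + D' h)\<bar> \<le> e * euclidean_norm h"
    if "h \<in> carrier_vec n" "euclidean_norm h < min r r'" for h
    using r(2)[of h] r'(2)[of h] that by (simp add: abs_if split: if_splits)
  then show "\<exists>r>0. \<forall>h\<in>carrier_vec n. euclidean_norm h < r \<longrightarrow>
      \<bar>F (v + h) + F' (v + h) - (F v + F' v) - (D h + D' h)\<bar> \<le> e * euclidean_norm h"
    using r(1) r'(1) by (intro exI[of _ "min r r'"]) auto
qed (simp_all add: has_frechet_derivative_additive[OF F] has_frechet_derivative_additive[OF F']
    has_frechet_derivative_homogeneous[OF F] has_frechet_derivative_homogeneous[OF F']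
    algebra_simps)

lemma has_frechet_derivative_scale:
  assumes F: "has_frechet_derivative n F D v"
  shows "has_frechet_derivative n (\<lambda>v. a * F v) (\<lambda>h. a * D h) v"
proof (rule has_frechet_derivativeI)
  fix e :: real assume "e > 0"
  \<comment> \<open>Dividing by \<open>\<bar>a\<bar> + 1\<close> rather than \<open>\<bar>a\<bar>\<close> covers \<open>a = 0\<close>.\<close>
  then have "e / (\<bar>a\<bar> + 1) > 0"
    by simp
  then obtain r where r: "r > 0" "\<And>h. h \<in> carrier_vec n \<Longrightarrow> euclidean_norm h < r \<Longrightarrow>
      \<bar>F (v + h) - F v - D h\<bar> \<le> e / (\<bar>a\<bar> + 1) * euclidean_norm h"
    using has_frechet_derivative_remainder[OF F] by metis
  have "\<bar>a * F (v + h) - a * F v - a * D h\<bar> \<le> e * euclidean_norm h"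
    if "h \<in> carrier_vec n" "euclidean_norm h < r" for h
  proof -
    have "\<bar>a * F (v + h) - a * F v - a * D h\<bar> = \<bar>a\<bar> * \<bar>F (v + h) - F v - D h\<bar>"
      by (simp add: abs_mult[symmetric] right_diff_distrib)
    also have "\<dots> \<le> (\<bar>a\<bar> + 1) * (e / (\<bar>a\<bar> + 1) * euclidean_norm h)"
      using r(2)[OF that] by (intro mult_mono) auto
    also have "\<dots> = e * euclidean_norm h"
      by simp
    finally show ?thesis .
  qed
  then show "\<exists>r>0. \<forall>h\<in>carrier_vec n. euclidean_norm h < r \<longrightarrow>
      \<bar>a * F (v + h) - a * F v - a * D h\<bar> \<le> e * euclidean_norm h"
    using r(1) by blast
qed (simp_all add: has_frechet_derivative_additive[OF F] has_frechet_derivative_homogeneous[OF F]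
    algebra_simps)

lemma has_frechet_derivative_compose_mat:
  assumes A: "A \<in> carrier_mat n m" and v: "v \<in> carrier_vec m"
    and F: "has_frechet_derivative n F D (A *\<^sub>v v)"
  shows "has_frechet_derivative m (\<lambda>u. F (A *\<^sub>v u)) (\<lambda>h. D (A *\<^sub>v h)) v"
proof (rule has_frechet_derivativeI)
  fix e :: real assume "e > 0"
  obtain K where "K > 0"
    and K: "\<And>v. v \<in> carrier_vec m \<Longrightarrow> euclidean_norm (A *\<^sub>v v) \<le> K * euclidean_norm v"
    using euclidean_norm_mult_mat_le[OF A] by metis
  have "e / K > 0"
    using \<open>e > 0\<close> \<open>K > 0\<close> by simp
  then obtain r where r: "r > 0" "\<And>h. h \<in> carrier_vec n \<Longrightarrow> euclidean_norm h < r \<Longrightarrow>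
      \<bar>F (A *\<^sub>v v + h) - F (A *\<^sub>v v) - D h\<bar> \<le> e / K * euclidean_norm h"
    using has_frechet_derivative_remainder[OF F] by metis
  have "\<bar>F (A *\<^sub>v (v + h)) - F (A *\<^sub>v v) - D (A *\<^sub>v h)\<bar> \<le> e * euclidean_norm h"
    if h: "h \<in> carrier_vec m" and small: "euclidean_norm h < r / K" for h
  proof -
    have "K * euclidean_norm h < r"
      using small \<open>K > 0\<close> by (simp add: field_simps)
    with K[OF h] have "euclidean_norm (A *\<^sub>v h) < r"
      by linarith
    moreover have "A *\<^sub>v h \<in> carrier_vec n"
      using A h by simp
    ultimately have "\<bar>F (A *\<^sub>v v + A *\<^sub>v h) - F (A *\<^sub>v v) - D (A *\<^sub>v h)\<bar>
        \<le> e / K * euclidean_norm (A *\<^sub>v h)"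
      by (intro r(2))
    also have "\<dots> \<le> e / K * (K * euclidean_norm h)"
      using \<open>e / K > 0\<close> by (intro mult_left_mono K[OF h]) simp
    also have "\<dots> = e * euclidean_norm h"
      using \<open>K > 0\<close> by simp
    finally show ?thesis
      by (simp add: mult_add_distrib_mat_vec[OF A v h])
  qed
  then show "\<exists>r>0. \<forall>h\<in>carrier_vec m. euclidean_norm h < r \<longrightarrow>
      \<bar>F (A *\<^sub>v (v + h)) - F (A *\<^sub>v v) - D (A *\<^sub>v h)\<bar> \<le> e * euclidean_norm h"
    using r(1) \<open>K > 0\<close> by (intro exI[of _ "r / K"]) auto
next
  fix h k :: "real vec" assume "h \<in> carrier_vec m" "k \<in> carrier_vec m"
  then show "D (A *\<^sub>v (h + k)) = D (A *\<^sub>v h) + D (A *\<^sub>v k)"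
    using A by (simp add: mult_add_distrib_mat_vec[OF A] has_frechet_derivative_additive[OF F])
next
  fix a :: real and h :: "real vec" assume "h \<in> carrier_vec m"
  then show "D (A *\<^sub>v (a \<cdot>\<^sub>v h)) = a * D (A *\<^sub>v h)"
    using A by (simp add: mult_mat_vec[OF A] has_frechet_derivative_homogeneous[OF F])
qed

section \<open>Closure properties of exact gradients\<close>

lemma exact_gradient_carrier:
  assumes "exact_gradient n G F" and "v \<in> carrier_vec n"
  shows "G v \<in> carrier_vec n"
  using assms by (auto simp: exact_gradient_def)

lemma exact_gradient_cong:
  assumes G: "exact_gradient n G F"
    and eq: "\<And>v. v \<in> carrier_vec n \<Longrightarrow> G' v = G v"
  shows "exact_gradient n G' F"
  using G by (auto simp: exact_gradient_def eq)

lemma exact_gradient_zero: "exact_gradient n (\<lambda>v. 0\<^sub>v n) (\<lambda>v. 0)"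
  unfolding exact_gradient_def
  by (auto intro!: has_frechet_derivative_cong[OF has_frechet_derivative_const]
      simp: grid_inner_def)

lemma exact_gradient_add:
  assumes G: "exact_gradient n G F" and G': "exact_gradient n G' F'"
  shows "exact_gradient n (\<lambda>v. G v + G' v) (\<lambda>v. F v + F' v)"
  unfolding exact_gradient_def
proof (intro conjI ballI)
  show "(\<lambda>v. G v + G' v) \<in> carrier_vec n \<rightarrow> carrier_vec n"
    using exact_gradient_carrier[OF G] exact_gradient_carrier[OF G'] by simp
  fix v :: "real vec" assume v: "v \<in> carrier_vec n"
  have "has_frechet_derivative n (\<lambda>v. F v + F' v)
      (\<lambda>h. grid_inner n (G v) h + grid_inner n (G' v) h) v"
    using G G' v by (intro has_frechet_derivative_add) (auto simp: exact_gradient_def)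
  then show "has_frechet_derivative n (\<lambda>v. F v + F' v) (\<lambda>h. grid_inner n (G v + G' v) h) v"
    by (rule has_frechet_derivative_cong)
      (use exact_gradient_carrier[OF G v] exact_gradient_carrier[OF G' v] in
        \<open>simp add: grid_inner_def add_scalar_prod_distrib add_divide_distrib\<close>)
qed

lemma exact_gradient_scale:
  assumes G: "exact_gradient n G F"
  shows "exact_gradient n (\<lambda>v. a \<cdot>\<^sub>v G v) (\<lambda>v. a * F v)"
  unfolding exact_gradient_def
proof (intro conjI ballI)
  show "(\<lambda>v. a \<cdot>\<^sub>v G v) \<in> carrier_vec n \<rightarrow> carrier_vec n"
    using G by (auto simp: exact_gradient_def)
  fix v :: "real vec" assume v: "v \<in> carrier_vec n"
  have "has_frechet_derivative n (\<lambda>v. a * F v) (\<lambda>h. a * grid_inner n (G v) h) v"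
    using G v by (intro has_frechet_derivative_scale) (auto simp: exact_gradient_def)
  then show "has_frechet_derivative n (\<lambda>v. a * F v) (\<lambda>h. grid_inner n (a \<cdot>\<^sub>v G v) h) v"
    by (rule has_frechet_derivative_cong)
      (use exact_gradient_carrier[OF G v] in \<open>simp add: grid_inner_def\<close>)
qed

lemma exact_gradient_diff:
  assumes G: "exact_gradient n G F" and G': "exact_gradient n G' F'"
  shows "exact_gradient n (\<lambda>v. G v - G' v) (\<lambda>v. F v + (- 1) * F' v)"
  by (rule exact_gradient_cong[OF exact_gradient_add[OF G exact_gradient_scale[OF G']]])
    (use exact_gradient_carrier[OF G] exact_gradient_carrier[OF G'] in
      \<open>auto intro!: eq_vecI\<close>)

lemma exact_gradient_finsum:
  assumes "finite K" and "\<And>l. l \<in> K \<Longrightarrow> exact_gradient n (G l) (F l)"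
  shows "exact_gradient n (\<lambda>v. finsum_vec TYPE(real) n (\<lambda>l. G l v) K) (\<lambda>v. \<Sum>l\<in>K. F l v)"
  using assms
proof (induction K rule: finite_induct)
  case empty
  show ?case
    using exact_gradient_zero by (simp add: finsum_vec_empty)
next
  case (insert l K)
  have step: "exact_gradient n (\<lambda>v. G l v + finsum_vec TYPE(real) n (\<lambda>l. G l v) K)
      (\<lambda>v. F l v + (\<Sum>l\<in>K. F l v))"
    using insert by (intro exact_gradient_add) auto
  have "finsum_vec TYPE(real) n (\<lambda>l. G l v) (insert l K)
      = G l v + finsum_vec TYPE(real) n (\<lambda>l. G l v) K" if "v \<in> carrier_vec n" for v
    using insert.hyps exact_gradient_carrier[OF insert.prems that]
    by (intro finsum_vec_insert) auto
  from exact_gradient_cong[OF step this] show ?case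
    using insert.hyps by simp
qed

text \<open>
  The adjoint of \<open>A\<close> with respect to the Euclidean inner products moves \<open>A\<close> from the direction to
  the gradient; the factor \<open>real n / real m\<close> of the potential converts the weight \<open>1 / n\<close> of the
  inner product on the codomain of \<open>A\<close> into the weight \<open>1 / m\<close> of the one on its domain.
\<close>

lemma exact_gradient_pullback:
  assumes A: "A \<in> carrier_mat n m" and "n > 0" and G: "exact_gradient n G F"
  shows "exact_gradient m (\<lambda>u. A\<^sup>T *\<^sub>v G (A *\<^sub>v u)) (\<lambda>u. (real n / real m) * F (A *\<^sub>v u))"
  unfolding exact_gradient_def
proof (intro conjI ballI)
  have "G (A *\<^sub>v u) \<in> carrier_vec n" if "u \<in> carrier_vec m" for u
    using A that by (intro exact_gradient_carrier[OF G] mult_mat_vec_carrier)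
  then show "(\<lambda>u. A\<^sup>T *\<^sub>v G (A *\<^sub>v u)) \<in> carrier_vec m \<rightarrow> carrier_vec m"
    using A by (intro Pi_I mult_mat_vec_carrier[of _ _ n]) auto
  fix u :: "real vec" assume u: "u \<in> carrier_vec m"
  have Au: "A *\<^sub>v u \<in> carrier_vec n"
    using A u by simp
  note GAu = exact_gradient_carrier[OF G Au]
  have "has_frechet_derivative n F (\<lambda>h. grid_inner n (G (A *\<^sub>v u)) h) (A *\<^sub>v u)"
    using G Au by (auto simp: exact_gradient_def)
  from has_frechet_derivative_scale[OF has_frechet_derivative_compose_mat[OF A u this]]
  have "has_frechet_derivative m (\<lambda>u. (real n / real m) * F (A *\<^sub>v u))
      (\<lambda>h. (real n / real m) * grid_inner n (G (A *\<^sub>v u)) (A *\<^sub>v h)) u" .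
  then show "has_frechet_derivative m (\<lambda>u. (real n / real m) * F (A *\<^sub>v u))
      (\<lambda>h. grid_inner m (A\<^sup>T *\<^sub>v G (A *\<^sub>v u)) h) u"
  proof (rule has_frechet_derivative_cong)
    fix h :: "real vec" assume h: "h \<in> carrier_vec m"
    have "(A\<^sup>T *\<^sub>v G (A *\<^sub>v u)) \<bullet> h = G (A *\<^sub>v u) \<bullet> (A *\<^sub>v h)"
      using transpose_vec_mult_scalar[OF A h GAu] by simp
    then show "grid_inner m (A\<^sup>T *\<^sub>v G (A *\<^sub>v u)) h
        = (real n / real m) * grid_inner n (G (A *\<^sub>v u)) (A *\<^sub>v h)"
      using \<open>n > 0\<close> by (simp add: grid_inner_def)
  qed
qed

section \<open>Transfer operators\<close>

lemma ascend_carrier: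
  assumes "\<And>j. j < k \<Longrightarrow> I (l + j) (l + Suc j) \<in> carrier_mat (N (l + Suc j)) (N (l + j))"
  shows "ascend N I l k \<in> carrier_mat (N (l + k)) (N l)"
  using assms by (induction k) force+

text \<open>
  The recursion of \<open>ascend\<close> adds the factor for the finest level.  The coarse samples of a
  correction pass first through the transfer from their own level, so the factor for the coarsest
  level has to be split off.
\<close>

lemma ascend_Suc_bottom:
  assumes "\<And>j. j < Suc k \<Longrightarrow> I (l + j) (l + Suc j) \<in> carrier_mat (N (l + Suc j)) (N (l + j))"
  shows "ascend N I l (Suc k) = ascend N I (Suc l) k * I l (Suc l)"
  using assms
proof (induction k)
  case 0
  from "0.prems"[of 0] show ?case
    by simp
next
  case (Suc k)
  have up: "I (l + Suc k) (l + Suc (Suc k)) \<in> carrier_mat (N (l + Suc (Suc k))) (N (l + Suc k))"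
    using Suc.prems[of "Suc k"] by simp
  have mid: "ascend N I (Suc l) k \<in> carrier_mat (N (l + Suc k)) (N (Suc l))"
    using ascend_carrier[of k I "Suc l" N] Suc.prems[of "Suc _"] by simp
  have low: "I l (Suc l) \<in> carrier_mat (N (Suc l)) (N l)"
    using Suc.prems[of 0] by simp
  have IH: "ascend N I l (Suc k) = ascend N I (Suc l) k * I l (Suc l)"
    using Suc.prems by (intro Suc.IH) auto
  have "ascend N I l (Suc (Suc k))
      = I (l + Suc k) (l + Suc (Suc k)) * (ascend N I (Suc l) k * I l (Suc l))"
    by (simp only: IH ascend.simps(2)[of N I l "Suc k"])
  also have "\<dots> = ascend N I (Suc l) (Suc k) * I l (Suc l)"
    using assoc_mult_mat[OF up mid low] by simp
  finally show ?case .
qed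

lemma transfer_operators_carrier:
  assumes "transfer_operators N Lbar c I" and "a \<le> Lbar" and "b \<le> Lbar"
  shows "I a b \<in> carrier_mat (N b) (N a)"
  using assms by (auto simp: transfer_operators_def)

lemma transfer_operators_ascend:
  assumes "transfer_operators N Lbar c I" and "a \<le> b" and "b \<le> Lbar"
  shows "I a b = ascend N I a (b - a)"
  using assms by (cases "a = b") (auto simp: transfer_operators_def)

lemma transfer_operators_compose_up:
  assumes T: "transfer_operators N Lbar c I" and "l < Lbar"
  shows "I (Suc l) Lbar * I l (Suc l) = I l Lbar"
proof -
  have "ascend N I l (Suc (Lbar - Suc l)) = ascend N I (Suc l) (Lbar - Suc l) * I l (Suc l)"
    using \<open>l < Lbar\<close> by (intro ascend_Suc_bottom transfer_operators_carrier[OF T]) auto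
  then show ?thesis
    using \<open>l < Lbar\<close> transfer_operators_ascend[OF T, of l Lbar]
      transfer_operators_ascend[OF T, of "Suc l" Lbar] by (simp add: Suc_diff_Suc)
qed

lemma transfer_operators_transpose:
  assumes T: "transfer_operators N Lbar c I" and "k \<le> Lbar"
  obtains s where "I k Lbar = s \<cdot>\<^sub>m (I Lbar k)\<^sup>T"
proof (cases "k = Lbar")
  case True
  have "I Lbar Lbar = 1\<^sub>m (N Lbar)"
    using T by (auto simp: transfer_operators_def)
  then have "I k Lbar = 1 \<cdot>\<^sub>m (I Lbar k)\<^sup>T"
    using True by (auto intro!: eq_matI)
  then show thesis
    by (rule that)
next
  case False
  then show thesis
    using T \<open>k \<le> Lbar\<close> that unfolding transfer_operators_def by blast
qed

text \<open>
  Here the transposition relation between the transfer operators enters: it turns the prolongation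
  \<open>I k Lbar\<close> into a multiple of the transposed restriction required by the pullback.
\<close>

lemma exact_gradient_transfer:
  assumes T: "transfer_operators N Lbar c I" and "k \<le> Lbar" and "N k > 0"
    and G: "\<exists>F. exact_gradient (N k) G F"
  shows "\<exists>J. exact_gradient (N Lbar) (\<lambda>u. I k Lbar *\<^sub>v G (I Lbar k *\<^sub>v u)) J"
proof -
  obtain F where F: "exact_gradient (N k) G F"
    using G by blast
  obtain s where s: "I k Lbar = s \<cdot>\<^sub>m (I Lbar k)\<^sup>T"
    using transfer_operators_transpose[OF T \<open>k \<le> Lbar\<close>] .
  have A: "I Lbar k \<in> carrier_mat (N k) (N Lbar)"
    using transfer_operators_carrier[OF T] \<open>k \<le> Lbar\<close> by simp
  have AT: "(I Lbar k)\<^sup>T \<in> carrier_mat (N Lbar) (N k)"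
    using A by simp
  have "I k Lbar *\<^sub>v G (I Lbar k *\<^sub>v u) = s \<cdot>\<^sub>v ((I Lbar k)\<^sup>T *\<^sub>v G (I Lbar k *\<^sub>v u))"
    if "u \<in> carrier_vec (N Lbar)" for u
    unfolding s using A that
    by (intro smult_mat_mult_vec[OF AT] exact_gradient_carrier[OF F]) simp
  from exact_gradient_cong[OF exact_gradient_scale[OF
        exact_gradient_pullback[OF A \<open>N k > 0\<close> F]] this]
  show ?thesis
    by blast
qed

section \<open>The multilevel gradient\<close>

theorem theorem6p1:
  fixes \<Omega> :: "'w set"
    and m0 d Lbar L :: nat
    and N :: "nat \<Rightarrow> nat"
    and c :: real
    and I :: "nat \<Rightarrow> nat \<Rightarrow> real mat"
    and Q :: "nat \<Rightarrow> real vec \<Rightarrow> 'w \<Rightarrow> 'w list \<Rightarrow> real vec"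
    and S :: "nat \<Rightarrow> 'w list"
  assumes "m0 \<ge> 1" and "d \<ge> 1"
    and N_def: "N = level_dim m0 d"
    and "c > 0"
    and transfer: "transfer_operators N Lbar c I"
    and Q_carrier: "\<And>l T \<omega> v. l \<le> Lbar \<Longrightarrow> sample_set \<Omega> T \<Longrightarrow> \<omega> \<in> set T \<Longrightarrow> v \<in> carrier_vec (N l)
           \<Longrightarrow> Q l v \<omega> T \<in> carrier_vec (N l)"
    and Q_gradient: "\<And>l T. l \<le> Lbar \<Longrightarrow> sample_set \<Omega> T
           \<Longrightarrow> \<exists>F. exact_gradient (N l) (\<lambda>v. sample_mean (N l) T (\<lambda>\<omega>. Q l v \<omega> T)) F"
    and "L \<le> Lbar"
    and samples: "\<And>l. l \<le> L \<Longrightarrow> sample_set \<Omega> (S l)"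
  shows "\<exists>J. exact_gradient (N Lbar) (mlmc_gradient N I Lbar Q L S) J"
proof -
  have N_pos: "N k > 0" for k
    using \<open>m0 \<ge> 1\<close> by (simp add: N_def level_dim_def)
  define M where "M k T v = sample_mean (N k) T (\<lambda>\<omega>. Q k v \<omega> T)" for k T v
  have transferred: "\<exists>J. exact_gradient (N Lbar) (\<lambda>u. I k Lbar *\<^sub>v M k T (I Lbar k *\<^sub>v u)) J"
    if "k \<le> Lbar" "sample_set \<Omega> T" for k T
    unfolding M_def using that
    by (intro exact_gradient_transfer[OF transfer _ N_pos] Q_gradient)
  define summand where "summand l u = I l Lbar *\<^sub>v sample_mean (N l) (S l)
     (\<lambda>\<omega>. if l = 0 then Q 0 (I Lbar 0 *\<^sub>v u) \<omega> (S 0)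
          else Q l (I Lbar l *\<^sub>v u) \<omega> (S l)
               - I (l - 1) l *\<^sub>v Q (l - 1) (I Lbar (l - 1) *\<^sub>v u) \<omega> (S l))" for l u
  have "\<exists>J. exact_gradient (N Lbar) (summand l) J" if "l \<in> {0..L}" for l
  proof (cases l)
    case 0
    have "summand l = (\<lambda>u. I 0 Lbar *\<^sub>v M 0 (S 0) (I Lbar 0 *\<^sub>v u))"
      by (simp add: fun_eq_iff summand_def M_def 0)
    then show ?thesis
      using transferred[of 0 "S 0"] samples[of 0] by simp
  next
    case (Suc k)
    have l: "l \<le> Lbar" and k: "k < Lbar" "k \<le> Lbar" and Sl: "sample_set \<Omega> (S l)"
      using that Suc \<open>L \<le> Lbar\<close> samples by auto
    obtain J J' where
      J: "exact_gradient (N Lbar) (\<lambda>u. I l Lbar *\<^sub>v M l (S l) (I Lbar l *\<^sub>v u)) J" and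
      J': "exact_gradient (N Lbar) (\<lambda>u. I k Lbar *\<^sub>v M k (S l) (I Lbar k *\<^sub>v u)) J'"
      using transferred[OF l Sl] transferred[OF k(2) Sl] by blast
    have "summand l u = I l Lbar *\<^sub>v M l (S l) (I Lbar l *\<^sub>v u)
        - I k Lbar *\<^sub>v M k (S l) (I Lbar k *\<^sub>v u)" if u: "u \<in> carrier_vec (N Lbar)" for u
    proof -
      note carrier = transfer_operators_carrier[OF transfer]
      have fine: "Q l (I Lbar l *\<^sub>v u) \<omega> (S l) \<in> carrier_vec (N l)" if "\<omega> \<in> set (S l)" for \<omega>
        using carrier[of Lbar l] l u by (intro Q_carrier[OF l Sl that]) simp
      have coarse: "Q k (I Lbar k *\<^sub>v u) \<omega> (S l) \<in> carrier_vec (N k)" if "\<omega> \<in> set (S l)" for \<omega>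
        using carrier[of Lbar k] k u by (intro Q_carrier[OF k(2) Sl that]) simp
      have Mf: "M l (S l) (I Lbar l *\<^sub>v u) \<in> carrier_vec (N l)"
        unfolding M_def using fine by (rule sample_mean_carrier)
      have Mc: "M k (S l) (I Lbar k *\<^sub>v u) \<in> carrier_vec (N k)"
        unfolding M_def using coarse by (rule sample_mean_carrier)
      have up: "I l Lbar \<in> carrier_mat (N Lbar) (N l)" and step: "I k l \<in> carrier_mat (N l) (N k)"
        using carrier l k by auto
      have "summand l u = I l Lbar *\<^sub>v sample_mean (N l) (S l)
          (\<lambda>\<omega>. Q l (I Lbar l *\<^sub>v u) \<omega> (S l) - I k l *\<^sub>v Q k (I Lbar k *\<^sub>v u) \<omega> (S l))"
        by (simp add: summand_def Suc)
      also have "\<dots> = I l Lbar *\<^sub>v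
          (M l (S l) (I Lbar l *\<^sub>v u) - I k l *\<^sub>v M k (S l) (I Lbar k *\<^sub>v u))"
        unfolding M_def using fine coarse by (subst sample_mean_diff_mult_mat[OF step]) auto
      also have "\<dots> = I l Lbar *\<^sub>v M l (S l) (I Lbar l *\<^sub>v u)
          - I l Lbar *\<^sub>v (I k l *\<^sub>v M k (S l) (I Lbar k *\<^sub>v u))"
        using step Mc by (intro mult_minus_distrib_mat_vec[OF up Mf]) simp
      also have "I l Lbar *\<^sub>v (I k l *\<^sub>v M k (S l) (I Lbar k *\<^sub>v u))
          = I k Lbar *\<^sub>v M k (S l) (I Lbar k *\<^sub>v u)"
        using assoc_mult_mat_vec[OF up step Mc] transfer_operators_compose_up[OF transfer k(1)]
        by (simp add: Suc)
      finally show ?thesis .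
    qed
    from exact_gradient_cong[OF exact_gradient_diff[OF J J'] this] show ?thesis
      by blast
  qed
  then obtain J where "\<And>l. l \<in> {0..L} \<Longrightarrow> exact_gradient (N Lbar) (summand l) (J l)"
    by metis
  from exact_gradient_finsum[OF finite_atLeastAtMost this]
  have "exact_gradient (N Lbar) (\<lambda>u. finsum_vec TYPE(real) (N Lbar) (\<lambda>l. summand l u) {0..L})
      (\<lambda>u. \<Sum>l\<in>{0..L}. J l u)" .
  moreover have "mlmc_gradient N I Lbar Q L S
      = (\<lambda>u. finsum_vec TYPE(real) (N Lbar) (\<lambda>l. summand l u) {0..L})"
    by (simp add: fun_eq_iff mlmc_gradient_def summand_def)
  ultimately show ?thesis
    by auto
qed

end
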